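(* Let $1<p<\infty$, let $T\in\mathcal L(\ell_p)$, let $\alpha_j\ge0$ for $j\in\mathbb N$, and assume that $\sum_{j=1}^\infty\alpha_j=1$. Then $$\sum_{j=1}^\infty\alpha_j\langle Te_j,J(e_j)\rangle\in W(T).$$
   Context: $\ell_p=\ell_p(\mathbb N)$ is the complex sequence space, $\mathcal L(\ell_p)$ its algebra of bounded linear operators, and $(e_j)_{j\ge1}$ its standard basis. With $1/p+1/q=1$, the dual $(\ell_p)^*$ is identified with $\ell_q$ via $\langle x,y\rangle=\sum_j x_j\overline{y_j}$. For $x=(x_j)\in\ell_p$ put $J(x)=(x_j|x_j|^{p-2})_j\in\ell_q$ (with $0$ in the coordinates where $x_j=0$). The numerical range is $W(T)=\{\langle Tx,J(x)\rangle:\ x\in\ell_p,\ \|x\|_p=1\}$. *)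

theory Defs
  imports "HOL-Analysis.Analysis"
begin

text \<open>Sequences are functions \<^typ>\<open>nat \<Rightarrow> complex\<close>, so coordinates are numbered from 0.
  The space depends on the real parameter \<open>p\<close>, hence it is a set and not a type.\<close>

definition lp :: "real \<Rightarrow> (nat \<Rightarrow> complex) set" where
  "lp p = {x. summable (\<lambda>j. norm (x j) powr p)}"

definition lp_norm :: "real \<Rightarrow> (nat \<Rightarrow> complex) \<Rightarrow> real" where
  "lp_norm p x = (\<Sum>j. norm (x j) powr p) powr (1 / p)"

text \<open>Only the restriction of \<open>T\<close> to \<^term>\<open>lp p\<close> matters; its values elsewhere are irrelevant.\<close>

definition bounded_operator_lp ::
    "real \<Rightarrow> ((nat \<Rightarrow> complex) \<Rightarrow> (nat \<Rightarrow> complex)) \<Rightarrow> bool" where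
  "bounded_operator_lp p T \<longleftrightarrow>
     (\<forall>x\<in>lp p. T x \<in> lp p) \<and>
     (\<forall>x\<in>lp p. \<forall>y\<in>lp p. T (\<lambda>j. x j + y j) = (\<lambda>j. T x j + T y j)) \<and>
     (\<forall>c. \<forall>x\<in>lp p. T (\<lambda>j. c * x j) = (\<lambda>j. c * T x j)) \<and>
     (\<exists>K. \<forall>x\<in>lp p. lp_norm p (T x) \<le> K * lp_norm p x)"

definition basis_seq :: "nat \<Rightarrow> nat \<Rightarrow> complex" where
  "basis_seq j = (\<lambda>i. if i = j then 1 else 0)"

text \<open>For \<open>x\<close> in \<open>lp p\<close> and \<open>y\<close> in \<open>lp q\<close> with \<open>1/p + 1/q = 1\<close> the series converges
  absolutely, by Hoelder's inequality.\<close>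

definition pairing :: "(nat \<Rightarrow> complex) \<Rightarrow> (nat \<Rightarrow> complex) \<Rightarrow> complex" where
  "pairing x y = (\<Sum>j. x j * cnj (y j))"

text \<open>Coordinates with \<open>x j = 0\<close> are sent to 0, also when \<open>p < 2\<close>.\<close>

definition duality_map :: "real \<Rightarrow> (nat \<Rightarrow> complex) \<Rightarrow> nat \<Rightarrow> complex" where
  "duality_map p x = (\<lambda>j. x j * of_real (norm (x j) powr (p - 2)))"

definition numerical_range ::
    "real \<Rightarrow> ((nat \<Rightarrow> complex) \<Rightarrow> (nat \<Rightarrow> complex)) \<Rightarrow> complex set" where
  "numerical_range p T = {pairing (T x) (duality_map p x) |x. x \<in> lp p \<and> lp_norm p x = 1}"

end

theory Submission
  imports Defs
begin

text \<open>
  Since \<open>\<langle>T e\<^sub>j, J e\<^sub>j\<rangle>\<close> is the diagonal entry \<open>t\<^sub>j\<close> of the matrix of \<open>T\<close>, the claim is that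
  \<open>\<Sum> \<alpha>\<^sub>j t\<^sub>j\<close> is a numerical value. The numerical range need not be convex when \<open>p \<noteq> 2\<close>, so
  convexity has to come from the disjointness of the supports of the \<open>e\<^sub>j\<close>.

  The infinite sum is no harder than a finite one: in a finite-dimensional space, an infinite
  convex combination of points lies in their convex hull, not just in its closure
  (\<open>infinite_convex_combination_in_hull\<close>). By Caratheodory's theorem \<open>\<Sum> \<alpha>\<^sub>j t\<^sub>j\<close> is then a convex
  combination of finitely many \<open>t\<^sub>j\<close>, with other weights.

  Finite combinations are built one index at a time. The inductive step
  (\<open>segment_in_numerical_values\<close>) is that for unit vectors \<open>u\<close> and \<open>v\<close> with disjoint supports the
  segment from \<open>\<langle>Tu, Ju\<rangle>\<close> to \<open>\<langle>Tv, Jv\<rangle>\<close> consists of numerical values. The vectors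
  \<open>s\<^bsup>1/p\<^esup> u + (1 - s)\<^bsup>1/p\<^esup> e v\<close> with \<open>0 \<le> s \<le> 1\<close> and \<open>\<bar>e\<bar> = 1\<close> are unit vectors, because the
  supports are disjoint; \<open>J\<close> acts on the two parts separately, for the same reason. For fixed
  \<open>s\<close>, their values trace an ellipse centred at the point
  \<open>s \<langle>Tu, Ju\<rangle> + (1 - s) \<langle>Tv, Jv\<rangle>\<close> of the segment. The ellipses vary continuously with \<open>s\<close> and
  shrink to the end points of the segment as \<open>s\<close> tends to 1 or 0. A point of the segment starts
  at the centre of one ellipse and ends up outside as \<open>s\<close> moves, so some ellipse passes through
  it. \<open>segment_covered_by_ellipses\<close> turns this into an application of the intermediate value
  theorem.
\<close>

section \<open>Infinite convex combinations in Euclidean space\<close>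

text \<open>If \<open>P\<close> were outside the hull, a linear functional would separate it weakly from the hull,
  in a direction of the affine span of both. Averaging the functional against \<open>\<alpha>\<close> gives its value
  at \<open>P\<close>, so it can exceed that value at no point of positive weight. It is therefore constant on
  the affine span, which contradicts the choice of direction.\<close>

lemma infinite_convex_combination_in_hull:
  fixes t :: "nat \<Rightarrow> 'a::euclidean_space"
  assumes nonneg: "\<And>j. 0 \<le> \<alpha> j" and one: "\<alpha> sums 1"
    and P: "(\<lambda>j. \<alpha> j *\<^sub>R t j) sums P"
  shows "P \<in> convex hull (t ` {j. 0 < \<alpha> j})"
proof (rule ccontr)
  define S where "S = convex hull (t ` {j. 0 < \<alpha> j})"
  assume "P \<notin> convex hull (t ` {j. 0 < \<alpha> j})"
  then have "P \<notin> S" by (simp add: S_def)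
  have "\<exists>j. 0 < \<alpha> j"
  proof (rule ccontr)
    assume "\<nexists>j. 0 < \<alpha> j"
    then have "\<alpha> = (\<lambda>_. 0)" using nonneg by (force simp: less_le)
    with one show False using sums_unique2[OF sums_zero] by fastforce
  qed
  then have "S \<noteq> {}" by (auto simp: S_def)
  moreover have "convex S" by (simp add: S_def)
  ultimately obtain a b where a: "P + a \<in> affine hull (insert P S)" "a \<noteq> 0"
    and aP: "a \<bullet> P \<le> b" and aS: "\<And>x. x \<in> S \<Longrightarrow> b \<le> a \<bullet> x"
    using separating_hyperplane_set_point_inaff[of S P] \<open>P \<notin> S\<close> by metis
  have "(\<lambda>j. a \<bullet> (\<alpha> j *\<^sub>R t j) - (a \<bullet> P) * \<alpha> j) sums (a \<bullet> P - (a \<bullet> P) * 1)"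
    by (intro sums_diff sums_mult one bounded_linear.sums[OF bounded_linear_inner_right] P)
  then have sums0: "(\<lambda>j. \<alpha> j * (a \<bullet> t j - a \<bullet> P)) sums 0"
    by (simp add: algebra_simps)
  have term_nonneg: "0 \<le> \<alpha> j * (a \<bullet> t j - a \<bullet> P)" for j
  proof (cases "0 < \<alpha> j")
    case True
    then have "t j \<in> S" by (auto simp: S_def intro: hull_inc)
    then show ?thesis using aS[of "t j"] aP nonneg[of j] by simp
  next
    case False
    then show ?thesis using nonneg[of j] by simp
  qed
  have "\<alpha> j * (a \<bullet> t j - a \<bullet> P) = 0" for j
    using suminf_eq_zero_iff[OF sums_summable[OF sums0] term_nonneg] sums_unique[OF sums0]
    by simp
  then have "t ` {j. 0 < \<alpha> j} \<subseteq> {y. a \<bullet> y = a \<bullet> P}" by force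
  then have "S \<subseteq> {y. a \<bullet> y = a \<bullet> P}"
    unfolding S_def by (intro hull_minimal convex_hyperplane)
  then have "affine hull (insert P S) \<subseteq> {y. a \<bullet> y = a \<bullet> P}"
    by (intro hull_minimal affine_hyperplane) auto
  with a show False by (auto simp: inner_add_right)
qed

section \<open>A segment covered by a family of ellipses\<close>

text \<open>The case \<open>a - d = 1\<close> of the next lemma; \<open>s - l\<close> is the displacement of the
  centre from the target. Choose \<open>e\<close>, depending on \<open>s\<close>, so that the offset
  \<open>h s * e * b + k s * cnj e * c\<close> is real. The whole expression
  is then real, at most 0 at \<open>s = 0\<close> and at least 0 at \<open>s = 1\<close>, and it only remains to make the choice
  continuous. The imaginary part of the offset is that of \<open>e D s\<close>, where \<open>D s\<close> is \<open>h s b\<close> minus the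
  conjugate of \<open>k s c\<close>. If \<open>D\<close> has no zero inside the interval, \<open>e\<close> can be the conjugate of
  \<open>sgn (D s)\<close>. If it has one, \<open>b\<close> and the conjugate of \<open>c\<close> are real multiples of one complex number,
  and a constant \<open>e\<close> serves.\<close>

lemma real_offset_vanishes:
  fixes b c :: complex and h k :: "real \<Rightarrow> real"
  assumes h: "continuous_on {0..1} h" "h 0 = 0" "h 1 = 0" "\<And>s. 0 < s \<Longrightarrow> s < 1 \<Longrightarrow> 0 < h s"
    and k: "continuous_on {0..1} k" "k 0 = 0" "k 1 = 0"
    and l: "0 \<le> l" "l \<le> 1"
  shows "\<exists>s\<in>{0..1}. \<exists>e. norm e = 1 \<and>
           of_real (s - l) + of_real (h s) * e * b + of_real (k s) * cnj e * c = 0"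
proof (cases "\<exists>e. norm e = 1 \<and> Im (e * b) = 0 \<and> Im (cnj e * c) = 0")
  case True
  then obtain e where e: "norm e = 1" "Im (e * b) = 0" "Im (cnj e * c) = 0" by blast
  then obtain b' c' where eb: "e * b = of_real b'" and ec: "cnj e * c = of_real c'"
    by (meson Reals_cases complex_is_Real_iff)
  define g where "g s = s - l + h s * b' + k s * c'" for s
  have "continuous_on {0..1} g"
    unfolding g_def by (intro continuous_intros h k)
  moreover have "g 0 \<le> 0" "0 \<le> g 1" using h k l by (auto simp: g_def)
  ultimately obtain s where s: "0 \<le> s" "s \<le> 1" "g s = 0"
    using IVT'[of g 0 0 1] by auto
  have "of_real (s - l) + of_real (h s) * e * b + of_real (k s) * cnj e * c = of_real (g s)"
    by (simp add: g_def eb ec mult.assoc)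
  with s e show ?thesis by (intro bexI[of _ s] exI[of _ e]) auto
next
  case False
  define B where "B s = of_real (h s) * b" for s
  define C where "C s = of_real (k s) * c" for s
  define D where "D s = B s - cnj (C s)" for s
  \<comment> \<open>The offset for the choice \<open>e = cnj (sgn (D s))\<close>. At \<open>s = 0\<close> and \<open>s = 1\<close> the quotient is 0/0,
     whose value 0 is the one that makes it continuous there.\<close>
  define \<phi> where "\<phi> s = ((norm (B s))\<^sup>2 - (norm (C s))\<^sup>2) / norm (D s)" for s
  have D_nz: "D s \<noteq> 0" if "0 < s" "s < 1" for s
  proof
    assume "D s = 0"
    then have b: "b = of_real (k s / h s) * cnj c"
      using h(4)[OF that] by (simp add: D_def B_def C_def field_simps)
    define e where "e = (if c = 0 then 1 else sgn c)"
    have ne: "norm e = 1" by (simp add: e_def norm_sgn)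
    have ec: "e * cnj c = of_real (norm c)"
      using complex_norm_square[of c, symmetric] by (simp add: e_def sgn_eq power2_eq_square)
    have "e * b = of_real (k s / h s) * (e * cnj c)" by (subst b) (rule mult.left_commute)
    then have "e * b = of_real (k s / h s * norm c)" by (simp only: ec of_real_mult)
    then have "Im (e * b) = 0" by (simp only: Im_complex_of_real)
    moreover have "cnj e * c = of_real (norm c)"
      using arg_cong[OF ec, of cnj] by simp
    then have "Im (cnj e * c) = 0" by (simp only: Im_complex_of_real)
    ultimately show False using False ne by blast
  qed
  have contB: "continuous_on {0..1} B" and contC: "continuous_on {0..1} C"
    unfolding B_def C_def by (intro continuous_intros h k)+
  have contD: "continuous_on {0..1} D"
    unfolding D_def by (intro continuous_intros contB contC)
  have ends: "B s = 0" "C s = 0" "D s = 0" "\<phi> s = 0" if "s = 0 \<or> s = 1" for s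
    using that h k by (auto simp: B_def C_def D_def \<phi>_def)
  have \<phi>_le: "\<bar>\<phi> s\<bar> \<le> norm (B s) + norm (C s)" for s
  proof -
    have "\<bar>norm (B s) - norm (C s)\<bar> \<le> norm (D s)"
      using norm_triangle_ineq3[of "B s" "cnj (C s)"] by (simp add: D_def)
    then have "\<bar>(norm (B s))\<^sup>2 - (norm (C s))\<^sup>2\<bar> \<le> (norm (B s) + norm (C s)) * norm (D s)"
      by (simp add: power2_eq_square square_diff_square_factored abs_mult mult_left_mono)
    then show ?thesis
      by (cases "D s = 0") (auto simp: \<phi>_def field_simps)
  qed
  have "continuous_on {0..1} \<phi>"
    unfolding continuous_on_def
  proof
    fix s :: real assume s: "s \<in> {0..1}"
    show "(\<phi> \<longlongrightarrow> \<phi> s) (at s within {0..1})"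
    proof (cases "s = 0 \<or> s = 1")
      case True
      have "((\<lambda>s. norm (B s) + norm (C s)) \<longlongrightarrow> norm (B s) + norm (C s)) (at s within {0..1})"
        using contB contC s by (auto simp: continuous_on_def intro!: tendsto_intros)
      then have "((\<lambda>s. norm (B s) + norm (C s)) \<longlongrightarrow> 0) (at s within {0..1})"
        using ends[OF True] by simp
      then have "(\<phi> \<longlongrightarrow> 0) (at s within {0..1})"
        by (rule Lim_null_comparison[rotated]) (simp add: \<phi>_le)
      with ends[OF True] show ?thesis by simp
    next
      case False
      with s have "D s \<noteq> 0" by (intro D_nz) auto
      then show ?thesis
        using contB contC contD s unfolding \<phi>_def
        by (auto simp: continuous_on_def intro!: tendsto_intros)
    qed
  qed
  then have "continuous_on {0..1} (\<lambda>s. s - l + \<phi> s)" by (intro continuous_intros)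
  then obtain s where s: "0 \<le> s" "s \<le> 1" and root: "s - l + \<phi> s = 0"
    using IVT'[of "\<lambda>s. s - l + \<phi> s" 0 0 1] ends l by auto
  show ?thesis
  proof (cases "s = 0 \<or> s = 1")
    case True
    with root ends[OF True] s h k show ?thesis
      by (intro bexI[of _ s] exI[of _ 1]) auto
  next
    case False
    with s have nz: "D s \<noteq> 0" by (intro D_nz) auto
    define e where "e = cnj (sgn (D s))"
    have "norm e = 1" using nz by (simp add: e_def norm_sgn)
    have "e * B s + cnj e * C s = (cnj (D s) * B s + D s * C s) / of_real (norm (D s))"
      by (simp add: e_def sgn_div_norm scaleR_conv_of_real divide_inverse algebra_simps)
    also have "cnj (D s) * B s + D s * C s = B s * cnj (B s) - C s * cnj (C s)"
      by (simp add: D_def algebra_simps)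
    also have "\<dots> = of_real ((norm (B s))\<^sup>2 - (norm (C s))\<^sup>2)"
      by (simp only: of_real_diff complex_norm_square)
    finally have "e * B s + cnj e * C s = of_real (\<phi> s)"
      by (simp add: \<phi>_def)
    moreover have "of_real (s - l) + of_real (h s) * e * b + of_real (k s) * cnj e * c
        = of_real (s - l) + (e * B s + cnj e * C s)"
      by (simp add: B_def C_def mult_ac)
    ultimately have "of_real (s - l) + of_real (h s) * e * b + of_real (k s) * cnj e * c
        = of_real (s - l + \<phi> s)" by simp
    with root s \<open>norm e = 1\<close> show ?thesis
      by (intro bexI[of _ s] exI[of _ e]) auto
  qed
qed

text \<open>Dividing by \<open>a - d\<close> turns the segment to the real direction. If \<open>a = d\<close>, the segment is a point
  and the ellipse at \<open>s = 0\<close> is that same point.\<close>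

lemma segment_covered_by_ellipses:
  fixes a b c d :: complex and h k :: "real \<Rightarrow> real"
  assumes h: "continuous_on {0..1} h" "h 0 = 0" "h 1 = 0" "\<And>s. 0 < s \<Longrightarrow> s < 1 \<Longrightarrow> 0 < h s"
    and k: "continuous_on {0..1} k" "k 0 = 0" "k 1 = 0"
    and l: "0 \<le> l" "l \<le> 1"
  shows "\<exists>s\<in>{0..1}. \<exists>e. norm e = 1 \<and>
           of_real s * a + of_real (1 - s) * d + of_real (h s) * e * b + of_real (k s) * cnj e * c
             = of_real l * a + of_real (1 - l) * d"
proof (cases "a = d")
  case True
  then show ?thesis
    using h k by (intro bexI[of _ 0] exI[of _ 1]) (auto simp: algebra_simps)
next
  case False
  obtain s e where s: "s \<in> {0..1}" "norm e = 1"
    and eq: "of_real (s - l) + of_real (h s) * e * (b / (a - d))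
              + of_real (k s) * cnj e * (c / (a - d)) = 0"
    using real_offset_vanishes[OF h k l, of "b / (a - d)" "c / (a - d)"] by blast
  have "of_real (s - l) * (a - d) + of_real (h s) * e * b + of_real (k s) * cnj e * c = 0"
    using arg_cong[OF eq, of "\<lambda>z. z * (a - d)"] False by (simp add: distrib_right)
  moreover have "of_real s * a + of_real (1 - s) * d + of_real (h s) * e * b + of_real (k s) * cnj e * c
      = of_real l * a + of_real (1 - l) * d
        + (of_real (s - l) * (a - d) + of_real (h s) * e * b + of_real (k s) * cnj e * c)"
    by (simp add: algebra_simps)
  ultimately show ?thesis
    using s by (intro bexI[of _ s] exI[of _ e]) simp_all
qed

section \<open>Finitely supported vectors\<close>

definition finite_sphere :: "real \<Rightarrow> nat set \<Rightarrow> (nat \<Rightarrow> complex) set" where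
  "finite_sphere p F = {x. (\<forall>j. j \<notin> F \<longrightarrow> x j = 0) \<and> (\<Sum>j\<in>F. norm (x j) powr p) = 1}"

lemma lp_finite_support:
  assumes "finite F" "\<And>j. j \<notin> F \<Longrightarrow> x j = 0"
  shows "x \<in> lp p"
  unfolding lp_def by (auto intro!: summable_finite[OF assms(1)] simp: assms(2))

lemma finite_sphere_lp:
  assumes "finite F" "x \<in> finite_sphere p F"
  shows "x \<in> lp p" "lp_norm p x = 1"
proof -
  have "(\<Sum>j. norm (x j) powr p) = (\<Sum>j\<in>F. norm (x j) powr p)"
    using assms by (intro suminf_finite) (auto simp: finite_sphere_def)
  then show "lp_norm p x = 1"
    using assms by (simp add: finite_sphere_def lp_norm_def)
  show "x \<in> lp p"
    using assms by (intro lp_finite_support[of F]) (auto simp: finite_sphere_def)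
qed

lemma pairing_duality_map_finite:
  assumes "finite F" "\<And>j. j \<notin> F \<Longrightarrow> x j = 0"
  shows "pairing y (duality_map p x) = (\<Sum>j\<in>F. y j * cnj (duality_map p x j))"
  unfolding pairing_def using assms by (intro suminf_finite) (auto simp: duality_map_def)

text \<open>Positively homogeneous of degree \<open>p - 1\<close>, as \<open>(s\<^bsup>1/p\<^esup>)\<^bsup>p - 1\<^esup> = s\<^bsup>1 - 1/p\<^esup>\<close>. It is stated for one
  coordinate because different parts of a vector will be scaled by different factors.\<close>

lemma duality_map_scale:
  fixes e :: complex
  assumes "1 < p" "0 \<le> s" "norm e = 1" "x i = of_real (s powr (1/p)) * e * y i"
  shows "duality_map p x i = of_real (s powr (1 - 1/p)) * e * duality_map p y i"
proof (cases "s = 0")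
  case True
  with assms show ?thesis by (simp add: duality_map_def)
next
  case False
  have "s powr (1/p) * (s powr (1/p)) powr (p - 2) = s powr (1 - 1/p)"
    using assms(1) by (simp add: powr_powr field_simps flip: powr_add)
  then have "of_real (s powr (1/p)) * of_real ((s powr (1/p)) powr (p - 2))
      = (of_real (s powr (1 - 1/p)) :: complex)"
    by (metis of_real_mult)
  then show ?thesis using assms
    by (simp add: duality_map_def norm_mult powr_mult mult_ac)
qed

lemma bounded_operator_lpD:
  assumes "bounded_operator_lp p T" "x \<in> lp p" "y \<in> lp p"
  shows "T (\<lambda>j. x j + y j) i = T x i + T y i" "T (\<lambda>j. c * x j) i = c * T x i"
  using assms by (simp_all add: bounded_operator_lp_def)

text \<open>For \<open>x = s\<^bsup>1/p\<^esup> u + (1 - s)\<^bsup>1/p\<^esup> e v\<close> the pairing \<open>\<langle>Tx, Jx\<rangle>\<close> splits into the four pairings of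
  \<open>Tu\<close> and \<open>Tv\<close> with \<open>Ju\<close> and \<open>Jv\<close>. The diagonal ones get the weights \<open>s\<close> and \<open>1 - s\<close>, because
  \<open>1/p + (1 - 1/p) = 1\<close> and the phase \<open>e\<close> cancels; the mixed ones trace the ellipse.\<close>

lemma segment_in_numerical_values:
  assumes p: "1 < p" and T: "bounded_operator_lp p T"
    and fin: "finite F" "finite G" and disj: "F \<inter> G = {}"
    and u: "u \<in> finite_sphere p F" and v: "v \<in> finite_sphere p G"
    and l: "0 \<le> l" "l \<le> 1"
  shows "\<exists>x\<in>finite_sphere p (F \<union> G). pairing (T x) (duality_map p x) =
      of_real l * pairing (T u) (duality_map p u) + of_real (1 - l) * pairing (T v) (duality_map p v)"
proof -
  define h where "h s = s powr (1 - 1/p) * (1 - s) powr (1/p)" for s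
  define k where "k s = s powr (1/p) * (1 - s) powr (1 - 1/p)" for s
  have cont: "continuous_on {0..1} h" "continuous_on {0..1} k"
    unfolding h_def k_def using p by (auto intro!: continuous_intros continuous_on_powr')
  define a where "a = pairing (T u) (duality_map p u)"
  define b where "b = pairing (T v) (duality_map p u)"
  define c where "c = pairing (T u) (duality_map p v)"
  define d where "d = pairing (T v) (duality_map p v)"
  have "\<exists>s\<in>{0..1}. \<exists>e. norm e = 1 \<and>
      of_real s * a + of_real (1 - s) * d + of_real (h s) * e * b + of_real (k s) * cnj e * c
        = of_real l * a + of_real (1 - l) * d"
    by (rule segment_covered_by_ellipses[OF cont(1) _ _ _ cont(2) _ _ l])
       (use p in \<open>auto simp: h_def k_def\<close>)
  then obtain s e where s: "0 \<le> s" "s \<le> 1" and e: "norm e = 1"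
    and eq: "of_real s * a + of_real (1 - s) * d + of_real (h s) * e * b + of_real (k s) * cnj e * c
        = of_real l * a + of_real (1 - l) * d" by auto
  define \<sigma> where "\<sigma> = (of_real (s powr (1/p)) :: complex)"
  define \<tau> where "\<tau> = of_real ((1 - s) powr (1/p)) * e"
  define x where "x = (\<lambda>j. \<sigma> * u j + \<tau> * v j)"
  have u0: "\<And>j. j \<notin> F \<Longrightarrow> u j = 0" and v0: "\<And>j. j \<notin> G \<Longrightarrow> v j = 0"
    and un: "(\<Sum>j\<in>F. norm (u j) powr p) = 1" and vn: "(\<Sum>j\<in>G. norm (v j) powr p) = 1"
    using u v by (auto simp: finite_sphere_def)
  have xF: "x j = \<sigma> * u j" if "j \<in> F" for j using that disj v0[of j] by (auto simp: x_def)
  have xG: "x j = \<tau> * v j" if "j \<in> G" for j using that disj u0[of j] by (auto simp: x_def)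
  have x0: "x j = 0" if "j \<notin> F \<union> G" for j using that u0 v0 by (simp add: x_def)
  have "(\<Sum>j\<in>F. norm (x j) powr p) = s * (\<Sum>j\<in>F. norm (u j) powr p)"
    using s p by (simp add: xF \<sigma>_def norm_mult powr_mult powr_powr sum_distrib_left)
  moreover have "(\<Sum>j\<in>G. norm (x j) powr p) = (1 - s) * (\<Sum>j\<in>G. norm (v j) powr p)"
    using s p e by (simp add: xG \<tau>_def norm_mult powr_mult powr_powr sum_distrib_left)
  ultimately have "x \<in> finite_sphere p (F \<union> G)"
    using x0 un vn by (simp add: finite_sphere_def sum.union_disjoint[OF fin disj])
  moreover have "pairing (T x) (duality_map p x) = of_real l * a + of_real (1 - l) * d"
  proof -
    have ulp: "u \<in> lp p" and vlp: "v \<in> lp p"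
      using finite_sphere_lp fin u v by auto
    have slp: "(\<lambda>j. \<sigma> * u j) \<in> lp p" "(\<lambda>j. \<tau> * v j) \<in> lp p"
      using fin u0 v0 by (auto intro: lp_finite_support)
    have Tx: "T x i = \<sigma> * T u i + \<tau> * T v i" for i
      using bounded_operator_lpD(1)[OF T slp] bounded_operator_lpD(2)[OF T ulp ulp]
        bounded_operator_lpD(2)[OF T vlp vlp] by (simp add: x_def)
    have JF: "duality_map p x j = of_real (s powr (1 - 1/p)) * duality_map p u j" if "j \<in> F" for j
      using duality_map_scale[OF p s(1), of 1 x j u] xF[OF that] by (simp add: \<sigma>_def)
    have JG: "duality_map p x j = of_real ((1 - s) powr (1 - 1/p)) * e * duality_map p v j"
      if "j \<in> G" for j
      using duality_map_scale[OF p _ e, of "1 - s" x j v] xG[OF that] s by (simp add: \<tau>_def)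
    have pu: "pairing y (duality_map p u) = (\<Sum>j\<in>F. y j * cnj (duality_map p u j))" for y
      by (rule pairing_duality_map_finite) (use fin u0 in auto)
    have pv: "pairing y (duality_map p v) = (\<Sum>j\<in>G. y j * cnj (duality_map p v j))" for y
      by (rule pairing_duality_map_finite) (use fin v0 in auto)
    have powrs: "r powr (1/p) * r powr (1 - 1/p) = r" if "0 \<le> r" for r
      using that by (simp flip: powr_add)
    have cs: "\<sigma> * of_real (s powr (1 - 1/p)) = of_real s"
      unfolding \<sigma>_def using powrs[OF s(1)] by (metis of_real_mult)
    have ec: "e * cnj e = 1"
      using e complex_norm_square[of e] by simp
    have "\<tau> * cnj (of_real ((1 - s) powr (1 - 1/p)) * e)
        = of_real ((1 - s) powr (1/p) * (1 - s) powr (1 - 1/p)) * (e * cnj e)"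
      by (simp add: \<tau>_def)
    then have ct: "\<tau> * cnj (of_real ((1 - s) powr (1 - 1/p)) * e) = of_real (1 - s)"
      using powrs[of "1 - s"] s ec by simp
    have "pairing (T x) (duality_map p x)
        = (\<Sum>j\<in>F. T x j * cnj (duality_map p x j)) + (\<Sum>j\<in>G. T x j * cnj (duality_map p x j))"
      using pairing_duality_map_finite[of "F \<union> G" x "T x" p] x0 fin
      by (simp add: sum.union_disjoint[OF fin disj])
    also have "(\<Sum>j\<in>F. T x j * cnj (duality_map p x j))
        = of_real (s powr (1 - 1/p)) * (\<sigma> * a + \<tau> * b)"
      by (simp add: a_def b_def pu Tx JF sum_distrib_left algebra_simps sum.distrib)
    also have "(\<Sum>j\<in>G. T x j * cnj (duality_map p x j))
        = cnj (of_real ((1 - s) powr (1 - 1/p)) * e) * (\<sigma> * c + \<tau> * d)"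
      by (simp add: c_def d_def pv Tx JG sum_distrib_left algebra_simps sum.distrib)
    also have "of_real (s powr (1 - 1/p)) * (\<sigma> * a + \<tau> * b)
        + cnj (of_real ((1 - s) powr (1 - 1/p)) * e) * (\<sigma> * c + \<tau> * d)
      = (\<sigma> * of_real (s powr (1 - 1/p))) * a
        + (\<tau> * cnj (of_real ((1 - s) powr (1 - 1/p)) * e)) * d
        + of_real (h s) * e * b + of_real (k s) * cnj e * c"
      by (simp add: h_def k_def algebra_simps) (simp add: \<sigma>_def \<tau>_def algebra_simps)
    finally show ?thesis by (simp only: cs ct eq)
  qed
  ultimately show ?thesis by (auto simp: a_def d_def)
qed

section \<open>Diagonal entries\<close>

lemma basis_seq_finite_sphere: "basis_seq j \<in> finite_sphere p {j}"
  by (simp add: finite_sphere_def basis_seq_def)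

lemma pairing_basis_seq: "pairing y (duality_map p (basis_seq j)) = y j"
  using pairing_duality_map_finite[of "{j}" "basis_seq j" y p]
  by (simp add: basis_seq_def duality_map_def)

text \<open>A point of the hull lies on a segment from the new entry to a value attained on the sphere of
  the previous indices, and the supports are disjoint because the new index is not among them.\<close>

lemma hull_of_diagonal_finite:
  assumes p: "1 < p" and T: "bounded_operator_lp p T"
    and "finite F" "F \<noteq> {}" and "z \<in> convex hull ((\<lambda>j. T (basis_seq j) j) ` F)"
  shows "\<exists>x\<in>finite_sphere p F. pairing (T x) (duality_map p x) = z"
  using assms(3-5)
proof (induction F arbitrary: z rule: finite_ne_induct)
  case (singleton j)
  then show ?case
    using basis_seq_finite_sphere[of j p] by (intro bexI[of _ "basis_seq j"])
      (auto simp: pairing_basis_seq)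
next
  case (insert n F)
  then obtain \<mu> \<nu> y where y: "0 \<le> \<mu>" "0 \<le> \<nu>" "\<mu> + \<nu> = 1"
      "y \<in> convex hull ((\<lambda>j. T (basis_seq j) j) ` F)"
      "z = \<mu> *\<^sub>R T (basis_seq n) n + \<nu> *\<^sub>R y"
    by (auto simp: convex_hull_insert)
  from insert.IH[OF y(4)] obtain u where u: "u \<in> finite_sphere p F"
    "pairing (T u) (duality_map p u) = y" by blast
  have "\<exists>x\<in>finite_sphere p ({n} \<union> F). pairing (T x) (duality_map p x) =
      of_real \<mu> * pairing (T (basis_seq n)) (duality_map p (basis_seq n))
      + of_real (1 - \<mu>) * pairing (T u) (duality_map p u)"
    using insert y by (intro segment_in_numerical_values p T basis_seq_finite_sphere u) auto
  moreover have "1 - \<mu> = \<nu>" using y by simp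
  ultimately show ?case
    by (simp add: y(5) u(2) pairing_basis_seq scaleR_conv_of_real)
qed

lemma norm_coordinate_le_lp_norm:
  assumes "0 < p" "x \<in> lp p"
  shows "norm (x j) \<le> lp_norm p x"
proof -
  have "norm (x j) powr p \<le> (\<Sum>i. norm (x i) powr p)"
    using sum_le_suminf[of "\<lambda>i. norm (x i) powr p" "{j}"] assms by (simp add: lp_def)
  then have "(norm (x j) powr p) powr (1/p) \<le> lp_norm p x"
    unfolding lp_norm_def using assms by (intro powr_mono2) auto
  then show ?thesis using assms by (simp add: powr_powr)
qed

text \<open>This makes the series in the theorem converge absolutely.\<close>

lemma diagonal_bounded:
  assumes "1 < p" "bounded_operator_lp p T"
  obtains K where "\<And>j. norm (T (basis_seq j) j) \<le> K"
proof -
  obtain K where K: "\<And>x. x \<in> lp p \<Longrightarrow> lp_norm p (T x) \<le> K * lp_norm p x"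
    using assms(2) unfolding bounded_operator_lp_def by blast
  have Tlp: "\<And>x. x \<in> lp p \<Longrightarrow> T x \<in> lp p"
    using assms(2) by (simp add: bounded_operator_lp_def)
  have "norm (T (basis_seq j) j) \<le> K" for j
  proof -
    have e: "basis_seq j \<in> lp p" "lp_norm p (basis_seq j) = 1"
      using finite_sphere_lp[OF _ basis_seq_finite_sphere] by auto
    then show ?thesis
      using norm_coordinate_le_lp_norm[OF _ Tlp[OF e(1)], of j] K[OF e(1)] assms by simp
  qed
  then show thesis by (rule that)
qed

theorem theorem3p3:
  fixes p :: real
    and T :: "(nat \<Rightarrow> complex) \<Rightarrow> (nat \<Rightarrow> complex)"
    and \<alpha> :: "nat \<Rightarrow> real"
  assumes "1 < p"
    and "bounded_operator_lp p T"
    and "\<And>j. 0 \<le> \<alpha> j"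
    and "\<alpha> sums 1"
  shows "(\<Sum>j. of_real (\<alpha> j) * pairing (T (basis_seq j)) (duality_map p (basis_seq j)))
           \<in> numerical_range p T"
proof -
  define t where "t j = T (basis_seq j) j" for j
  define P where "P = (\<Sum>j. \<alpha> j *\<^sub>R t j)"
  obtain K where K: "\<And>j. norm (t j) \<le> K"
    using diagonal_bounded[OF assms(1,2)] unfolding t_def by blast
  have "summable (\<lambda>j. \<alpha> j *\<^sub>R t j)"
  proof (rule summable_comparison_test')
    show "summable (\<lambda>j. \<alpha> j * K)"
      using assms(4) by (intro summable_mult2 sums_summable)
    show "norm (\<alpha> j *\<^sub>R t j) \<le> \<alpha> j * K" if "0 \<le> j" for j
      using K[of j] assms(3)[of j] by (simp add: mult_left_mono)
  qed
  then have "(\<lambda>j. \<alpha> j *\<^sub>R t j) sums P"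
    unfolding P_def by (rule summable_sums)
  from infinite_convex_combination_in_hull[OF assms(3,4) this]
  obtain S where S: "finite S" "S \<subseteq> t ` {j. 0 < \<alpha> j}" "P \<in> convex hull S"
    unfolding caratheodory[of "t ` _"] by blast
  obtain F where F: "finite F" "S = t ` F"
    using finite_subset_image[OF S(1,2)] by blast
  have "F \<noteq> {}" using S F by auto
  then obtain x where "x \<in> finite_sphere p F" "pairing (T x) (duality_map p x) = P"
    using hull_of_diagonal_finite[OF assms(1,2) F(1), of P] S F unfolding t_def by blast
  then have "P \<in> numerical_range p T"
    unfolding numerical_range_def using finite_sphere_lp[OF F(1)] by blast
  then show ?thesis
    by (simp add: P_def t_def pairing_basis_seq scaleR_conv_of_real)
qed

end
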